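(* Let $\mathcal X,\mathcal Y$ be compact metrizable spaces, let $F:\mathcal X\times\mathcal Y\to(0,+\infty)$ be continuous, let $G:[0,+\infty)\to\mathbb R$ be convex and differentiable on $(0,+\infty)$, with $G'(0):=\lim_{u\to0^+}G'(u)\in\mathbb R\cup\{-\infty\}$, and let $$c(x,m)=G\left(\int F(x,y)\,m(dy)\right),\qquad x\in\mathcal X,\ m\in\mathcal M(\mathcal Y),$$ be assumed jointly lower semicontinuous. Let $\mu\in\mathcal P(\mathcal X)$ and $\nu\in\mathcal P(\mathcal Y)$ be such that $\mathcal I_c(\mu,\nu)<+\infty$, and suppose that $\bar q\in\mathcal Q(\mu,\nu)$ is a kernel minimizer of $\mathcal I_c(\mu,\nu)$ and that $\bar f\in\mathcal L^1(\nu)$ is a dual optimizer: $$\mathcal I_c(\mu,\nu)=\int c(x,\bar q^x)\,\mu(dx)=\int K_c\bar f\,d\mu-\int\bar f\,d\nu.$$ Then, for $\mu$-almost all $x\in\mathcal X$, $$G'\left(\int F(x,z)\,\bar q^x(dz)\right)F(x,y)+\bar f(y)\ge0,\qquad\forall y\in\mathcal Y.\qquad( * )$$ In particular, if $G'(0)=-\infty$, then $\bar q^x(\mathcal Y)>0$ for $\mu$-almost all $x\in\mathcal X$. Moreover, for $\mu$-almost all $x\in\mathcal X$, equality holds in $( * )$ for $\bar q^x$-almost all $y\in\mathcal Y$.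
   Context: $\mathcal P(E)$: Borel probability measures on $E$; $\mathcal M(\mathcal Y)$: finite nonnegative Borel measures on $\mathcal Y$ with the weak topology. A nonnegative kernel is a family $q=(q^x)_{x\in\mathcal X}$ in $\mathcal M(\mathcal Y)$ with $x\mapsto q^x(A)$ measurable for all Borel $A\subset\mathcal Y$. $\mathcal Q(\mu,\nu)$ is the set of nonnegative kernels with $\int q^x(dy)\,\mu(dx)=\nu(dy)$, and $\mathcal I_c(\mu,\nu)=\inf_{q\in\mathcal Q(\mu,\nu)}\int c(x,q^x)\,\mu(dx)$. $\mathcal L^1(\nu)$ is the set of measurable $f:\mathcal Y\to\mathbb R$ with $\int|f|\,d\nu<\infty$. For $f\in\mathcal L^1(\nu)$, $K_cf(x)=\inf\left\{\int f\,dm+c(x,m):\ m\in\mathcal M(\mathcal Y),\ \int|f|\,dm<\infty\right\}$, $x\in\mathcal X$. *)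

theory Defs
  imports "HOL-Probability.Probability"
begin

definition Borel_probs :: "'e::topological_space measure set"
  where "Borel_probs = {\<mu>. sets \<mu> = sets borel \<and> prob_space \<mu>}"

definition Borel_fin_measures :: "'e::topological_space measure set"
  where "Borel_fin_measures = {m. sets m = sets borel \<and> finite_measure m}"

text \<open>The weak topology on finite Borel measures: the coarsest one for which integration
  against each bounded continuous real function is continuous.\<close>

definition weak_measure_topology :: "'e::topological_space measure topology"
  where "weak_measure_topology = topology_generated_by
    {{m \<in> Borel_fin_measures. (\<integral>y. \<phi> y \<partial>m) \<in> U} |(\<phi> :: 'e \<Rightarrow> real) U.
       continuous_on UNIV \<phi> \<and> bounded (range \<phi>) \<and> open U}"

definition lower_semicontinuous_map :: "'e topology \<Rightarrow> ('e \<Rightarrow> ereal) \<Rightarrow> bool"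
  where "lower_semicontinuous_map T h \<longleftrightarrow> (\<forall>a. openin T {z \<in> topspace T. a < h z})"

text \<open>Integral of an extended real function, as positive part minus negative part. If both
  parts are infinite the value is \<open>\<infinity>\<close>, because \<open>\<infinity> - \<infinity> = \<infinity>\<close> on \<^typ>\<open>ereal\<close>.\<close>

definition ereal_integral :: "'e measure \<Rightarrow> ('e \<Rightarrow> ereal) \<Rightarrow> ereal"
  where "ereal_integral M h =
    enn2ereal (\<integral>\<^sup>+x. e2ennreal (h x) \<partial>M) - enn2ereal (\<integral>\<^sup>+x. e2ennreal (- h x) \<partial>M)"

definition nonneg_kernel :: "('a::topological_space \<Rightarrow> 'b::topological_space measure) \<Rightarrow> bool"
  where "nonneg_kernel q \<longleftrightarrow> (\<forall>x. q x \<in> Borel_fin_measures) \<and>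
    (\<forall>A \<in> sets borel. (\<lambda>x. emeasure (q x) A) \<in> borel_measurable borel)"

definition kernels ::
  "'a::topological_space measure \<Rightarrow> 'b::topological_space measure \<Rightarrow> ('a \<Rightarrow> 'b measure) set"
  where "kernels \<mu> \<nu> = {q. nonneg_kernel q \<and>
    (\<forall>A \<in> sets borel. (\<integral>\<^sup>+x. emeasure (q x) A \<partial>\<mu>) = emeasure \<nu> A)}"

definition transport_value ::
  "('a::topological_space \<Rightarrow> 'b::topological_space measure \<Rightarrow> ereal) \<Rightarrow>
    'a measure \<Rightarrow> 'b measure \<Rightarrow> ereal"
  where "transport_value c \<mu> \<nu> = (INF q \<in> kernels \<mu> \<nu>. ereal_integral \<mu> (\<lambda>x. c x (q x)))"

definition K_transform ::
  "('a::topological_space \<Rightarrow> 'b::topological_space measure \<Rightarrow> ereal) \<Rightarrow> ('b \<Rightarrow> real) \<Rightarrow>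
    'a \<Rightarrow> ereal"
  where "K_transform c f x =
    (INF m \<in> {m \<in> Borel_fin_measures. integrable m f}. ereal (\<integral>y. f y \<partial>m) + c x m)"

definition integral_cost ::
  "(real \<Rightarrow> real) \<Rightarrow> ('a \<times> 'b::topological_space \<Rightarrow> real) \<Rightarrow> 'a \<Rightarrow> 'b measure \<Rightarrow> ereal"
  where "integral_cost G F x m = ereal (G (\<integral>y. F (x, y) \<partial>m))"

text \<open>The derivative of \<open>G\<close> on \<open>(0, \<infinity>)\<close>, extended to \<open>0\<close> by its right limit there. That limit
  exists in \<open>[-\<infinity>, \<infinity>)\<close> when \<open>G\<close> is convex, since the derivative is then nondecreasing.\<close>

definition ext_deriv :: "(real \<Rightarrow> real) \<Rightarrow> real \<Rightarrow> ereal"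
  where "ext_deriv G u =
    (if u = 0 then Lim (at_right 0) (\<lambda>v. ereal (deriv G v)) else ereal (deriv G u))"

end

theory Submission
  imports Defs
begin

text \<open>Write \<open>u x = \<integral>F (x, z) dq x\<close>. The function \<open>x \<mapsto> \<integral>f dq x + G (u x)\<close> dominates \<open>K_transform c f\<close>
  at every \<open>x\<close> for which \<open>f\<close> is integrable against \<open>q x\<close>, that is, almost everywhere,
  since \<open>q x\<close> is a competitor in the infimum that defines the transform. Disintegrating \<open>\<nu>\<close>
  along \<open>q\<close>, the primal and dual optimality of \<open>q\<close> and \<open>f\<close> say that both functions have the same
  finite integral, so they agree almost everywhere: for almost every \<open>x\<close> the measure \<open>q x\<close>
  minimizes \<open>m \<mapsto> \<integral>f dm + G (\<integral>F (x, \<cdot>) dm)\<close> (\<open>dual_optimizer_attains_K_transform\<close>). The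
  conclusion then consists of first-order conditions for this convex problem at a fixed \<open>x\<close>
  (\<open>minimizing_measure_optimality\<close>). If \<open>u x > 0\<close>, dilations of \<open>q x\<close> give \<open>\<integral>f dq x + u x * G' (u x) = 0\<close>, and
  point masses give \<open>G' (u x) * F (x, y) + f y \<ge> 0\<close> for every \<open>y\<close>. The integral over \<open>q x\<close> of the
  left-hand side of this inequality is the left-hand side of the preceding equation, so a
  nonnegative function has integral zero, and equality holds \<open>q x\<close>-almost everywhere. If
  \<open>u x = 0\<close>, then \<open>q x = 0\<close>, the equality is void, and the inequality, again from point masses,
  bounds \<open>G' 0\<close> from below, which excludes \<open>G' 0 = -\<infinity>\<close>.

  The step from equal integrals to almost everywhere equality needs measurability.
  Compactness provides it twice: \<open>x \<mapsto> \<integral>F (x, \<cdot>) dm\<close> is continuous for each fixed \<open>m\<close>, which makes the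
  transform upper semicontinuous (\<open>K_transform_measurable\<close>), and \<open>F\<close> is measurable for the product
  \<open>\<sigma>\<close>-algebra (\<open>continuous_compact_product_measurable\<close>), which makes \<open>u\<close> measurable. The tangent of
  \<open>G\<close> at \<open>1\<close> keeps the transport cost from being \<open>-\<infinity>\<close> (\<open>integral_cost_integrable\<close>).\<close>

section \<open>Tangents of the convex cost profile\<close>

lemma differentiable_on_pos_has_deriv:
  fixes G :: "real \<Rightarrow> real"
  assumes "G differentiable_on {0<..}" "0 < s"
  shows "(G has_real_derivative deriv G s) (at s)"
  using assms
  by (metis DERIV_deriv_iff_real_differentiable at_within_open differentiable_on_def
      greaterThan_iff open_greaterThan)

lemma convex_above_tangent_at_pos:
  fixes G :: "real \<Rightarrow> real"
  assumes "convex_on {0..} G" "G differentiable_on {0<..}" "0 < s" "0 \<le> t"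
  shows "deriv G s * (t - s) \<le> G t - G s"
proof (rule convex_on_imp_above_tangent[OF assms(1)])
  show "connected {0::real..}" by simp
  show "s \<in> interior {0::real..}" using assms(3) by simp
  show "t \<in> {0..}" using assms(4) by simp
  show "(G has_real_derivative deriv G s) (at s within {0..})"
    using differentiable_on_pos_has_deriv[OF assms(2,3)] has_field_derivative_at_within by blast
qed

lemma convex_deriv_mono:
  fixes G :: "real \<Rightarrow> real"
  assumes "convex_on {0..} G" "G differentiable_on {0<..}" "0 < s" "s \<le> t"
  shows "deriv G s \<le> deriv G t"
proof (cases "s = t")
  case False
  have "deriv G s * (t - s) \<le> deriv G t * (t - s)"
    using convex_above_tangent_at_pos[OF assms(1,2,3), of t]
      convex_above_tangent_at_pos[OF assms(1,2), of t s] assms(3,4)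
    by (simp add: algebra_simps)
  then show ?thesis using False assms(4) by (simp add: mult_le_cancel_right)
qed simp

lemma ext_deriv_pos: "0 < u \<Longrightarrow> ext_deriv G u = ereal (deriv G u)"
  by (simp add: ext_deriv_def)

text \<open>Because \<open>G'\<close> is nondecreasing, its right limit at \<open>0\<close> is its infimum, so any lower bound
  for \<open>G'\<close> on \<open>(0, \<infinity>)\<close> passes to the limit.\<close>

lemma ext_deriv_zero_ge:
  fixes G :: "real \<Rightarrow> real"
  assumes "convex_on {0..} G" "G differentiable_on {0<..}"
    and bound: "\<And>v. 0 < v \<Longrightarrow> b \<le> deriv G v"
  shows "ereal b \<le> ext_deriv G 0"
proof -
  define L where "L = (INF v\<in>{0<..}. ereal (deriv G v))"
  have "((\<lambda>v. ereal (deriv G v)) \<longlongrightarrow> L) (at_right 0)"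
  proof (rule order_tendstoI)
    fix a assume a: "a < L"
    have "a < ereal (deriv G v)" if "0 < v" for v
      using a that unfolding L_def by (meson INF_lower greaterThan_iff less_le_trans)
    then show "\<forall>\<^sub>F v in at_right 0. a < ereal (deriv G v)"
      by (auto simp: eventually_at_right_field intro!: exI[of _ 1])
  next
    fix a assume "L < a"
    then obtain w where w: "0 < w" "ereal (deriv G w) < a"
      by (auto simp: L_def INF_less_iff)
    have "ereal (deriv G v) < a" if "0 < v" "v < w" for v
      using convex_deriv_mono[OF assms(1,2) that(1), of w] that w(2)
      by (meson ereal_less_eq(3) le_less_trans less_imp_le)
    then show "\<forall>\<^sub>F v in at_right 0. ereal (deriv G v) < a"
      using w(1) by (auto simp: eventually_at_right_field)
  qed
  then have "ext_deriv G 0 = L"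
    unfolding ext_deriv_def by (simp add: tendsto_Lim)
  moreover have "ereal b \<le> L"
    unfolding L_def by (intro INF_greatest) (simp add: bound)
  ultimately show ?thesis by simp
qed

lemma differentiable_on_pos_continuous:
  fixes G :: "real \<Rightarrow> real"
  shows "G differentiable_on {0<..} \<Longrightarrow> continuous_on {0<..} G"
  by (rule differentiable_imp_continuous_on)

text \<open>On \<open>[0, \<infinity>)\<close> continuity can fail only at \<open>0\<close>, so \<open>G\<close> becomes Borel once its values on the
  negative half line, where it is arbitrary, are replaced by a constant.\<close>

lemma differentiable_on_pos_borel_measurable:
  fixes G :: "real \<Rightarrow> real"
  assumes "G differentiable_on {0<..}" and u: "u \<in> borel_measurable M"
    and nonneg: "\<And>x. x \<in> space M \<Longrightarrow> 0 \<le> u x"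
  shows "(\<lambda>x. G (u x)) \<in> borel_measurable M"
proof -
  have G: "(\<lambda>t. if t \<in> {0<..} then G t else G 0) \<in> borel_measurable borel"
    by (intro borel_measurable_continuous_on_if differentiable_on_pos_continuous assms(1)) auto
  have "(\<lambda>x. if u x \<in> {0<..} then G (u x) else G 0) \<in> borel_measurable M"
    using measurable_compose[OF u G] .
  then show ?thesis
    by (rule measurable_cong[THEN iffD1, rotated]) (use nonneg in \<open>force simp: order.order_iff_strict\<close>)
qed

section \<open>First-order conditions for a minimizing measure\<close>

lemma scaled_measure_integral:
  fixes f :: "'b::topological_space \<Rightarrow> real"
  assumes "m \<in> Borel_fin_measures" "integrable m f" "0 \<le> t"
  shows "density m (\<lambda>_. ennreal t) \<in> Borel_fin_measures"
    and "integrable (density m (\<lambda>_. ennreal t)) f"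
    and "(\<integral>y. f y \<partial>density m (\<lambda>_. ennreal t)) = t * (\<integral>y. f y \<partial>m)"
proof -
  have m: "sets m = sets borel" "finite_measure m"
    using assms(1) by (auto simp: Borel_fin_measures_def)
  have f: "f \<in> borel_measurable m" using assms(2) by auto
  have "emeasure (density m (\<lambda>_. ennreal t)) (space m) \<noteq> \<infinity>"
    using finite_measure.emeasure_finite[OF m(2)]
    by (simp add: emeasure_density_const ennreal_mult_eq_top_iff)
  then show "density m (\<lambda>_. ennreal t) \<in> Borel_fin_measures"
    using m by (auto simp: Borel_fin_measures_def intro!: finite_measureI)
  show "integrable (density m (\<lambda>_. ennreal t)) f"
    using f assms(2,3) by (subst integrable_density) auto
  show "(\<integral>y. f y \<partial>density m (\<lambda>_. ennreal t)) = t * (\<integral>y. f y \<partial>m)"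
    using f assms(3) by (subst integral_density) auto
qed

lemma point_mass_integral:
  fixes f :: "'b::topological_space \<Rightarrow> real"
  assumes "f \<in> borel_measurable borel"
  shows "return borel y \<in> Borel_fin_measures" "integrable (return borel y) f"
    and "(\<integral>z. f z \<partial>return borel y) = f y"
proof -
  interpret prob_space "return borel y" by (rule prob_space_return) simp
  show "return borel y \<in> Borel_fin_measures"
    by (simp add: Borel_fin_measures_def finite_measure_axioms)
  have "AE z in return borel y. norm (f z) \<le> norm (f y)"
    using assms by (subst AE_return) auto
  then show "integrable (return borel y) f"
    using assms by (intro integrable_const_bound[where B = "norm (f y)"]) auto
  show "(\<integral>z. f z \<partial>return borel y) = f y"
    using assms by (simp add: integral_return)
qed

text \<open>Write \<open>u\<close> for \<open>\<integral>\<phi> dm\<close>. If \<open>u > 0\<close>, then dilating \<open>m\<close> by factors near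
  \<open>1\<close> in both directions gives \<open>\<integral>f dm = - u * G' u\<close>, and the competitor \<open>s \<delta>\<^sub>y\<close> whose mass \<open>s\<close> is
  chosen so that \<open>s * \<phi> y = u\<close> leaves the \<open>G\<close>-term unchanged; comparing the linear terms gives
  the pointwise inequality. If \<open>u = 0\<close>, then \<open>m\<close> is the zero measure and the competitors
  \<open>s \<delta>\<^sub>y\<close> bound \<open>G'\<close> from below near \<open>0\<close>.\<close>

lemma minimizing_measure_optimality:
  fixes G :: "real \<Rightarrow> real" and \<phi> f :: "'b::topological_space \<Rightarrow> real"
  assumes convex: "convex_on {0..} G" and diff: "G differentiable_on {0<..}"
    and m: "m \<in> Borel_fin_measures" and f: "integrable m f"
    and \<phi>: "integrable m \<phi>" "\<And>y. 0 < \<phi> y"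
    and meas: "f \<in> borel_measurable borel" "\<phi> \<in> borel_measurable borel"
    and min: "\<And>m'. m' \<in> Borel_fin_measures \<Longrightarrow> integrable m' f \<Longrightarrow>
      (\<integral>y. f y \<partial>m) + G (\<integral>y. \<phi> y \<partial>m) \<le> (\<integral>y. f y \<partial>m') + G (\<integral>y. \<phi> y \<partial>m')"
  shows "0 \<le> ext_deriv G (\<integral>y. \<phi> y \<partial>m) * ereal (\<phi> y) + ereal (f y)"
    and "AE y in m. ext_deriv G (\<integral>y. \<phi> y \<partial>m) * ereal (\<phi> y) + ereal (f y) = 0"
proof -
  define u where "u = (\<integral>y. \<phi> y \<partial>m)"
  define A where "A = (\<integral>y. f y \<partial>m)"
  have u0: "0 \<le> u"
    unfolding u_def by (intro integral_nonneg_AE AE_I2) (simp add: \<phi>(2) less_imp_le)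
  have point: "A + G u \<le> s * f y + G (s * \<phi> y)" if "0 \<le> s" for s y
    using min[of "density (return borel y) (\<lambda>_. ennreal s)"] that
      scaled_measure_integral[OF point_mass_integral(1,2)[OF meas(1)] that, of y]
      scaled_measure_integral[OF point_mass_integral(1,2)[OF meas(2)] that, of y]
      point_mass_integral(3)[OF meas(1), of y] point_mass_integral(3)[OF meas(2), of y]
    by (simp add: A_def u_def)
  have scale: "A + G u \<le> s * A + G (s * u)" if "0 \<le> s" for s
    using min[of "density m (\<lambda>_. ennreal s)"]
      scaled_measure_integral[OF m f that] scaled_measure_integral[OF m \<phi>(1) that]
    by (simp add: A_def u_def)
  have "(\<forall>y. 0 \<le> ext_deriv G u * ereal (\<phi> y) + ereal (f y)) \<and>
    (AE y in m. ext_deriv G u * ereal (\<phi> y) + ereal (f y) = 0)"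
  proof (cases "u = 0")
    case True
    have "AE y in m. \<phi> y = 0"
      using integral_nonneg_eq_0_iff_AE[OF \<phi>(1)] \<phi>(2) True by (simp add: u_def less_imp_le)
    then have null: "AE y in m. False"
      using \<phi>(2) by (auto elim!: eventually_mono simp: less_imp_neq[symmetric])
    then have "(\<integral>y. f y \<partial>m) = (\<integral>y. 0 \<partial>m)"
      using f by (intro integral_cong_AE) auto
    then have A0: "A = 0" by (simp add: A_def)
    have "0 \<le> ext_deriv G 0 * ereal (\<phi> y) + ereal (f y)" for y
    proof -
      have "- f y / \<phi> y \<le> deriv G v" if "0 < v" for v
      proof -
        have "G 0 \<le> v / \<phi> y * f y + G v"
          using point[of "v / \<phi> y" y] \<phi>(2)[of y] that A0 True by simp
        moreover have "G v - G 0 \<le> deriv G v * v"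
          using convex_above_tangent_at_pos[OF convex diff that, of 0] by simp
        ultimately have "0 \<le> v * (f y / \<phi> y + deriv G v)"
          by (simp add: algebra_simps)
        then have "0 \<le> f y / \<phi> y + deriv G v"
          using that by (simp add: zero_le_mult_iff)
        then show ?thesis by simp
      qed
      then have "ereal (- f y / \<phi> y) \<le> ext_deriv G 0"
        by (rule ext_deriv_zero_ge[OF convex diff])
      then have "ereal (- f y / \<phi> y) * ereal (\<phi> y) \<le> ext_deriv G 0 * ereal (\<phi> y)"
        by (rule ereal_mult_right_mono) (simp add: \<phi>(2) less_imp_le)
      then have "ereal (- f y) \<le> ext_deriv G 0 * ereal (\<phi> y)"
        using \<phi>(2)[of y] by (simp add: less_imp_neq[symmetric])
      then show ?thesis
        by (cases "ext_deriv G 0 * ereal (\<phi> y)") auto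
    qed
    then show ?thesis using null True by (auto elim: eventually_mono)
  next
    case False
    then have upos: "0 < u" using u0 by simp
    have "((\<lambda>s. s * A + G (s * u)) has_real_derivative A + deriv G u * u) (at 1)"
    proof -
      have "(G has_real_derivative deriv G u) (at (1 * u))"
        using differentiable_on_pos_has_deriv[OF diff upos] by simp
      then have "((\<lambda>s. G (s * u)) has_real_derivative deriv G u * u) (at 1)"
        by (rule DERIV_chain2) (auto intro!: derivative_eq_intros)
      then show ?thesis by (auto intro!: derivative_eq_intros)
    qed
    then have "A + deriv G u * u = 0"
      by (rule DERIV_local_min[where d = 1]) (use scale in auto)
    then have A: "A = - (deriv G u * u)" by simp
    have ineq: "0 \<le> deriv G u * \<phi> y + f y" for y
    proof -
      have "- (deriv G u * u) \<le> u / \<phi> y * f y"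
        using point[of "u / \<phi> y" y] \<phi>(2)[of y] upos A by (simp add: less_imp_neq[symmetric])
      then have "0 \<le> u * (deriv G u * \<phi> y + f y)"
        using \<phi>(2)[of y] by (simp add: field_simps)
      then show ?thesis using upos by (simp add: zero_le_mult_iff)
    qed
    have "(\<integral>y. deriv G u * \<phi> y + f y \<partial>m) = 0"
      using \<phi>(1) f A by (simp add: u_def A_def)
    then have "AE y in m. deriv G u * \<phi> y + f y = 0"
      using integral_nonneg_eq_0_iff_AE[of m "\<lambda>y. deriv G u * \<phi> y + f y"] \<phi>(1) f ineq by simp
    then show ?thesis
      using ineq upos by (simp add: ext_deriv_pos zero_ereal_def)
  qed
  then show "0 \<le> ext_deriv G (\<integral>y. \<phi> y \<partial>m) * ereal (\<phi> y) + ereal (f y)"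
    and "AE y in m. ext_deriv G (\<integral>y. \<phi> y \<partial>m) * ereal (\<phi> y) + ereal (f y) = 0"
    by (simp_all add: u_def)
qed

section \<open>Integration against kernels\<close>

text \<open>A finite kernel need not have bounded mass, but dividing \<open>q x\<close> by \<open>1 + q x UNIV\<close> makes it a
  sub-probability kernel, for which joint measurability is available; the factor is undone
  afterwards.\<close>

lemma nonneg_kernel_nn_integral_measurable:
  fixes q :: "'a::topological_space \<Rightarrow> 'b::topological_space measure"
  assumes q: "nonneg_kernel q" and h: "(\<lambda>(x, y). h x y) \<in> borel_measurable (borel \<Otimes>\<^sub>M borel)"
  shows "(\<lambda>x. \<integral>\<^sup>+y. h x y \<partial>q x) \<in> borel_measurable borel"
proof -
  define w :: "'a \<Rightarrow> ennreal" where "w x = 1 + emeasure (q x) UNIV" for x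
  define p where "p x = scale_measure (1 / w x) (q x)" for x
  have sets_q: "sets (q x) = sets borel" and fin: "finite_measure (q x)" for x
    using q by (auto simp: nonneg_kernel_def Borel_fin_measures_def)
  have space_q: "space (q x) = UNIV" for x
    using sets_eq_imp_space_eq[OF sets_q] by simp
  have em[measurable]: "(\<lambda>x. emeasure (q x) B) \<in> borel_measurable borel" if "B \<in> sets borel" for B
    using q that by (auto simp: nonneg_kernel_def)
  have w_meas[measurable]: "w \<in> borel_measurable borel"
    unfolding w_def by measurable
  have w0: "w x \<noteq> 0" for x by (simp add: w_def)
  have wtop: "w x \<noteq> \<top>" for x
    using finite_measure.emeasure_finite[OF fin, of x UNIV] by (simp add: w_def)
  have inv: "w x * (1 / w x) = 1" for x
    using w0[of x] wtop[of x] by (simp add: ennreal_times_divide less_top)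
  have "p \<in> measurable borel (subprob_algebra borel)"
  proof (rule measurable_subprob_algebra)
    fix x :: 'a
    show "sets (p x) = sets borel" by (simp add: p_def sets_q)
    have "emeasure (q x) UNIV * (1 / w x) \<le> w x * (1 / w x)"
      by (rule mult_right_mono) (simp_all add: w_def)
    then have "emeasure (p x) (space (p x)) \<le> 1"
      unfolding inv by (simp add: p_def space_q space_scale_measure mult.commute)
    then show "subprob_space (p x)"
      by (intro subprob_spaceI) (simp_all add: p_def space_q space_scale_measure)
  next
    fix B :: "'b set" assume [measurable]: "B \<in> sets borel"
    show "(\<lambda>x. emeasure (p x) B) \<in> borel_measurable borel"
      unfolding p_def emeasure_scale_measure by measurable
  qed
  then have "(\<lambda>x. \<integral>\<^sup>+y. h x y \<partial>p x) \<in> borel_measurable borel"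
    using h by (rule nn_integral_measurable_subprob_algebra2[rotated])
  then have "(\<lambda>x. w x * (\<integral>\<^sup>+y. h x y \<partial>p x)) \<in> borel_measurable borel"
    by measurable
  moreover have "w x * (\<integral>\<^sup>+y. h x y \<partial>p x) = (\<integral>\<^sup>+y. h x y \<partial>q x)" for x
  proof -
    have "(\<lambda>y. h x y) \<in> borel_measurable (q x)"
      using measurable_compose[OF measurable_Pair1' h, of x] sets_q[of x]
      by (simp cong: measurable_cong_sets)
    then have "(\<integral>\<^sup>+y. h x y \<partial>p x) = 1 / w x * (\<integral>\<^sup>+y. h x y \<partial>q x)"
      unfolding p_def by (rule nn_integral_scale_measure)
    then show ?thesis
      using inv[of x] by (simp only: mult.assoc[symmetric] mult_1)
  qed
  ultimately show ?thesis by simp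
qed

lemma nonneg_kernel_nn_integral_measurable_snd:
  fixes q :: "'a::topological_space \<Rightarrow> 'b::topological_space measure"
  assumes "nonneg_kernel q" "h \<in> borel_measurable borel"
  shows "(\<lambda>x. \<integral>\<^sup>+y. h y \<partial>q x) \<in> borel_measurable borel"
proof (rule nonneg_kernel_nn_integral_measurable[OF assms(1)])
  show "(\<lambda>(x :: 'a, y). h y) \<in> borel_measurable (borel \<Otimes>\<^sub>M borel)"
    unfolding case_prod_beta by (rule measurable_compose[OF measurable_snd assms(2)])
qed

lemma kernels_nn_integral:
  fixes q :: "'a::topological_space \<Rightarrow> 'b::topological_space measure"
  assumes q: "q \<in> kernels \<mu> \<nu>" and \<mu>: "sets \<mu> = sets borel" and \<nu>: "sets \<nu> = sets borel"
    and h: "h \<in> borel_measurable borel"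
  shows "(\<integral>\<^sup>+x. \<integral>\<^sup>+y. h y \<partial>q x \<partial>\<mu>) = (\<integral>\<^sup>+y. h y \<partial>\<nu>)"
proof -
  have ker: "nonneg_kernel q" using q by (simp add: kernels_def)
  have sets_q[measurable_cong]: "sets (q x) = sets borel" for x
    using ker by (auto simp: nonneg_kernel_def Borel_fin_measures_def)
  note \<mu>[measurable_cong] \<nu>[measurable_cong]
  have inner[measurable]: "(\<lambda>x. \<integral>\<^sup>+y. g y \<partial>q x) \<in> borel_measurable \<mu>"
    if "g \<in> borel_measurable borel" for g
    using nonneg_kernel_nn_integral_measurable_snd[OF ker that] \<mu>
    by (simp cong: measurable_cong_sets)
  show ?thesis
    using h
  proof induction
    case (cong f g)
    then have "f = g" by auto
    with cong show ?case by simp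
  next
    case (set A)
    then show ?case using q sets_q \<nu> by (simp add: kernels_def)
  next
    case (mult u c)
    note [measurable] = mult.hyps(2)
    show ?case using mult.IH by (simp add: nn_integral_cmult)
  next
    case (add u v)
    note [measurable] = add.hyps(1,3)
    show ?case using add.IH by (simp add: nn_integral_add)
  next
    case (seq U)
    note [measurable] = seq.hyps(1)
    have inc: "incseq (\<lambda>i x. \<integral>\<^sup>+y. U i y \<partial>q x)"
      using seq.hyps(3) by (auto simp: incseq_def le_fun_def intro!: nn_integral_mono)
    have "(\<integral>\<^sup>+y. (SUP i. U i) y \<partial>q x) = (SUP i. \<integral>\<^sup>+y. U i y \<partial>q x)" for x
      unfolding SUP_apply using seq.hyps(3) by (intro nn_integral_monotone_convergence_SUP) auto
    then have "(\<integral>\<^sup>+x. \<integral>\<^sup>+y. (SUP i. U i) y \<partial>q x \<partial>\<mu>) = (SUP i. \<integral>\<^sup>+x. \<integral>\<^sup>+y. U i y \<partial>q x \<partial>\<mu>)"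
      using inc by (simp add: nn_integral_monotone_convergence_SUP)
    also have "\<dots> = (SUP i. \<integral>\<^sup>+y. U i y \<partial>\<nu>)" using seq.IH by simp
    also have "\<dots> = (\<integral>\<^sup>+y. (SUP i. U i) y \<partial>\<nu>)"
      unfolding SUP_apply using seq.hyps(3)
      by (intro nn_integral_monotone_convergence_SUP[symmetric]) auto
    finally show ?case .
  qed
qed

text \<open>Fubini for kernels. The function \<open>g\<close> is the inner integral made total: off the null set where
  \<open>f\<close> fails to be integrable against \<open>q x\<close> it agrees with \<open>\<integral>f dq x\<close>.\<close>

lemma kernels_integral:
  fixes q :: "'a::topological_space \<Rightarrow> 'b::topological_space measure" and f :: "'b \<Rightarrow> real"
  assumes q: "q \<in> kernels \<mu> \<nu>" and \<mu>: "sets \<mu> = sets borel" and \<nu>: "sets \<nu> = sets borel"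
    and f: "integrable \<nu> f"
  obtains g where "integrable \<mu> g" "(\<integral>x. g x \<partial>\<mu>) = (\<integral>y. f y \<partial>\<nu>)"
    "AE x in \<mu>. integrable (q x) f \<and> (\<integral>y. f y \<partial>q x) = g x"
proof -
  have ker: "nonneg_kernel q" using q by (simp add: kernels_def)
  have sets_q[measurable_cong]: "sets (q x) = sets borel" for x
    using ker by (auto simp: nonneg_kernel_def Borel_fin_measures_def)
  note \<mu>[measurable_cong] \<nu>[measurable_cong]
  have fm[measurable]: "f \<in> borel_measurable borel"
    using f \<nu> by (auto dest!: borel_measurable_integrable cong: measurable_cong_sets)
  define P where "P x = (\<integral>\<^sup>+y. ennreal (f y) \<partial>q x)" for x
  define N where "N x = (\<integral>\<^sup>+y. ennreal (- f y) \<partial>q x)" for x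
  have meas[measurable]: "P \<in> borel_measurable \<mu>" "N \<in> borel_measurable \<mu>"
    unfolding P_def N_def measurable_cong_sets[OF \<mu> refl]
    by (intro nonneg_kernel_nn_integral_measurable_snd[OF ker]; measurable)+
  have intP: "(\<integral>\<^sup>+x. P x \<partial>\<mu>) = (\<integral>\<^sup>+y. ennreal (f y) \<partial>\<nu>)"
    and intN: "(\<integral>\<^sup>+x. N x \<partial>\<mu>) = (\<integral>\<^sup>+y. ennreal (- f y) \<partial>\<nu>)"
    unfolding P_def N_def by (intro kernels_nn_integral[OF q \<mu> \<nu>]; measurable)+
  have finP: "(\<integral>\<^sup>+x. P x \<partial>\<mu>) \<noteq> \<infinity>" and finN: "(\<integral>\<^sup>+x. N x \<partial>\<mu>) \<noteq> \<infinity>"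
    using f by (simp_all add: intP intN real_integrable_def)
  have aeP: "AE x in \<mu>. P x \<noteq> \<infinity>" and aeN: "AE x in \<mu>. N x \<noteq> \<infinity>"
    using nn_integral_noteq_infinite[OF meas(1) finP] nn_integral_noteq_infinite[OF meas(2) finN] by auto
  have iP: "integrable \<mu> (\<lambda>x. enn2real (P x)) \<and> (\<integral>x. enn2real (P x) \<partial>\<mu>) = enn2real (\<integral>\<^sup>+x. P x \<partial>\<mu>)"
    and iN: "integrable \<mu> (\<lambda>x. enn2real (N x)) \<and> (\<integral>x. enn2real (N x) \<partial>\<mu>) = enn2real (\<integral>\<^sup>+x. N x \<partial>\<mu>)"
  proof -
    have "(\<integral>\<^sup>+x. ennreal (enn2real (P x)) \<partial>\<mu>) = (\<integral>\<^sup>+x. P x \<partial>\<mu>)"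
      using aeP by (intro nn_integral_cong_AE) (auto elim!: eventually_mono simp: less_top)
    then show "integrable \<mu> (\<lambda>x. enn2real (P x)) \<and> (\<integral>x. enn2real (P x) \<partial>\<mu>) = enn2real (\<integral>\<^sup>+x. P x \<partial>\<mu>)"
      using finP by (auto simp: integrable_iff_bounded integral_eq_nn_integral less_top)
    have "(\<integral>\<^sup>+x. ennreal (enn2real (N x)) \<partial>\<mu>) = (\<integral>\<^sup>+x. N x \<partial>\<mu>)"
      using aeN by (intro nn_integral_cong_AE) (auto elim!: eventually_mono simp: less_top)
    then show "integrable \<mu> (\<lambda>x. enn2real (N x)) \<and> (\<integral>x. enn2real (N x) \<partial>\<mu>) = enn2real (\<integral>\<^sup>+x. N x \<partial>\<mu>)"
      using finN by (auto simp: integrable_iff_bounded integral_eq_nn_integral less_top)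
  qed
  show ?thesis
  proof (rule that)
    show "integrable \<mu> (\<lambda>x. enn2real (P x) - enn2real (N x))" using iP iN by simp
    show "(\<integral>x. enn2real (P x) - enn2real (N x) \<partial>\<mu>) = (\<integral>y. f y \<partial>\<nu>)"
      using iP iN by (simp add: real_lebesgue_integral_def[OF f] intP intN)
    show "AE x in \<mu>. integrable (q x) f \<and> (\<integral>y. f y \<partial>q x) = enn2real (P x) - enn2real (N x)"
      using aeP aeN
    proof eventually_elim
      case (elim x)
      then have "integrable (q x) f" by (auto simp: real_integrable_def P_def N_def)
      then show ?case by (simp add: real_lebesgue_integral_def P_def N_def)
    qed
  qed
qed

section \<open>Continuous functions on a compact product\<close>

text \<open>An open set need not lie in the product \<open>\<sigma>\<close>-algebra, each of whose members is generated by
  countably many rectangles. Here compactness supplies countability: \<open>{F < a}\<close> is the union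
  of the compact sets \<open>{F \<le> a - 1/(n+1)}\<close>, and finitely many open rectangles inside
  \<open>{F < a}\<close> cover each of them.\<close>

lemma continuous_compact_product_measurable:
  fixes F :: "'a::topological_space \<times> 'b::topological_space \<Rightarrow> real"
  assumes compact: "compact (UNIV :: 'a set)" "compact (UNIV :: 'b set)"
    and F: "continuous_on UNIV F"
  shows "F \<in> borel_measurable (borel \<Otimes>\<^sub>M borel)"
proof (rule borel_measurableI_less)
  fix a :: real
  let ?U = "{z. F z < a}"
  have U: "open ?U" using F by (intro open_Collect_less) auto
  have cpt: "compact (UNIV :: ('a \<times> 'b) set)"
    using compact_Times[OF compact] by simp
  have "\<exists>R. {z. F z \<le> a - 1 / real (Suc n)} \<subseteq> R \<and> R \<subseteq> ?U \<and> R \<in> sets (borel \<Otimes>\<^sub>M borel)" for n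
  proof -
    let ?C = "{z. F z \<le> a - 1 / real (Suc n)}"
    have "closed ?C" using F by (intro closed_Collect_le) auto
    then have "compact ?C" using compact_Int_closed[OF cpt] by simp
    moreover define I where "I = {(A, B). open A \<and> open B \<and> A \<times> B \<subseteq> ?U}"
    have sub: "?C \<subseteq> (\<Union>(A, B)\<in>I. A \<times> B)"
    proof
      fix z assume "z \<in> ?C"
      moreover have "0 < 1 / real (Suc n)" by simp
      ultimately have "z \<in> ?U" unfolding mem_Collect_eq by linarith
      then obtain A B where "open A" "open B" "z \<in> A \<times> B" "A \<times> B \<subseteq> ?U"
        by (rule open_prod_elim[OF U])
      then show "z \<in> (\<Union>(A, B)\<in>I. A \<times> B)" by (force simp: I_def)
    qed
    moreover have "open (case i of (A, B) \<Rightarrow> A \<times> B)" if "i \<in> I" for i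
      using that by (auto simp: I_def open_Times)
    ultimately obtain I' where I': "I' \<subseteq> I" "finite I'" "?C \<subseteq> (\<Union>(A, B)\<in>I'. A \<times> B)"
      by (metis (no_types, lifting) compactE_image)
    have "(\<Union>(A, B)\<in>I'. A \<times> B) \<in> sets (borel \<Otimes>\<^sub>M borel)"
      using I'(1,2) by (intro sets.finite_UN) (auto simp: I_def)
    moreover have "(\<Union>(A, B)\<in>I'. A \<times> B) \<subseteq> ?U" using I'(1) by (auto simp: I_def)
    ultimately show ?thesis using I'(3) by blast
  qed
  then obtain R where R: "\<And>n. {z. F z \<le> a - 1 / real (Suc n)} \<subseteq> R n" "\<And>n. R n \<subseteq> ?U"
    "\<And>n. R n \<in> sets (borel \<Otimes>\<^sub>M borel)" by metis
  have "?U \<subseteq> (\<Union>n. R n)"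
  proof
    fix z assume "z \<in> ?U"
    then obtain n where "1 / real (Suc n) < a - F z"
      using nat_approx_posE[of "a - F z"] by auto
    then have "z \<in> {z. F z \<le> a - 1 / real (Suc n)}" by simp
    then show "z \<in> (\<Union>n. R n)" using R(1) by blast
  qed
  then have "?U = (\<Union>n. R n)" using R(2) by blast
  moreover have "(\<Union>n. R n) \<in> sets (borel \<Otimes>\<^sub>M borel)" using R(3) by blast
  ultimately show "{z \<in> space (borel \<Otimes>\<^sub>M borel). F z < a} \<in> sets (borel \<Otimes>\<^sub>M borel)"
    by (simp add: space_pair_measure)
qed

lemma continuous_compact_product_bound:
  fixes F :: "'a::topological_space \<times> 'b::topological_space \<Rightarrow> real"
  assumes "compact (UNIV :: 'a set)" "compact (UNIV :: 'b set)" "continuous_on UNIV F"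
  obtains B where "0 < B" "\<And>z. \<bar>F z\<bar> \<le> B"
proof -
  have "bounded (range F)"
    using compact_continuous_image[OF assms(3)] compact_Times[OF assms(1,2)]
    by (simp add: compact_imp_bounded)
  then obtain B where "0 < B" "\<forall>t\<in>range F. norm t \<le> B" unfolding bounded_pos by blast
  then show ?thesis using that by auto
qed

lemma continuous_section_measurable:
  fixes F :: "'a::topological_space \<times> 'b::topological_space \<Rightarrow> real"
  assumes "continuous_on UNIV F"
  shows "(\<lambda>y. F (x, y)) \<in> borel_measurable borel"
  by (intro borel_measurable_continuous_onI continuous_on_compose2[OF assms])
    (auto intro!: continuous_intros)

lemma continuous_section_integrable:
  fixes F :: "'a::topological_space \<times> 'b::topological_space \<Rightarrow> real"
  assumes "compact (UNIV :: 'a set)" "compact (UNIV :: 'b set)" "continuous_on UNIV F"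
    and m: "m \<in> Borel_fin_measures"
  shows "integrable m (\<lambda>y. F (x, y))"
proof -
  obtain B where "\<And>z. \<bar>F z\<bar> \<le> B"
    using continuous_compact_product_bound[OF assms(1-3)] by metis
  moreover have "finite_measure m" "(\<lambda>y. F (x, y)) \<in> borel_measurable m"
    using m continuous_section_measurable[OF assms(3)]
    by (auto simp: Borel_fin_measures_def cong: measurable_cong_sets)
  ultimately show ?thesis
    by (intro finite_measure.integrable_const_bound[where B = B]) auto
qed

text \<open>By compactness of the second factor the sections \<open>F (x, \<cdot>)\<close> converge uniformly
  to \<open>F (x\<^sub>0, \<cdot>)\<close> as \<open>x\<close> tends to \<open>x\<^sub>0\<close>, so their integrals converge.\<close>

lemma continuous_on_integral_section:
  fixes F :: "'a::topological_space \<times> 'b::topological_space \<Rightarrow> real"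
  assumes compact: "compact (UNIV :: 'a set)" "compact (UNIV :: 'b set)"
    and F: "continuous_on UNIV F" and m: "m \<in> Borel_fin_measures"
  shows "continuous_on UNIV (\<lambda>x. \<integral>y. F (x, y) \<partial>m)"
proof -
  interpret finite_measure m using m by (simp add: Borel_fin_measures_def)
  note int = continuous_section_integrable[OF compact F m]
  have "((\<lambda>x. \<integral>y. F (x, y) \<partial>m) \<longlongrightarrow> (\<integral>y. F (x0, y) \<partial>m)) (at x0)" for x0
  proof (rule tendstoI)
    fix e :: real assume e: "0 < e"
    define M where "M = measure m (space m)"
    have M: "0 \<le> M" by (simp add: M_def)
    define d where "d = e / (M + 1)"
    have d: "0 < d" using e M by (simp add: d_def)
    obtain X0 where X0: "x0 \<in> X0" "open X0"
      "\<forall>x\<in>X0 \<inter> UNIV. \<forall>y\<in>UNIV. dist (F (x, y)) (F (x0, y)) \<le> d"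
      using continuous_on_prod_compactE[of UNIV UNIV F x0 d] F compact(2) d by auto
    have "dist (\<integral>y. F (x, y) \<partial>m) (\<integral>y. F (x0, y) \<partial>m) < e" if "x \<in> X0" for x
    proof -
      have "\<bar>(\<integral>y. F (x, y) \<partial>m) - (\<integral>y. F (x0, y) \<partial>m)\<bar> = \<bar>\<integral>y. F (x, y) - F (x0, y) \<partial>m\<bar>"
        using int by simp
      also have "\<dots> \<le> (\<integral>y. \<bar>F (x, y) - F (x0, y)\<bar> \<partial>m)" by (rule integral_abs_bound)
      also have "\<dots> \<le> (\<integral>y. d \<partial>m)"
        using int X0(3) that by (intro integral_mono) (auto simp: dist_real_def)
      also have "\<dots> = d * M" by (simp add: M_def)
      also have "\<dots> < d * (M + 1)" using d by simp
      also have "\<dots> = e" using M by (simp add: d_def)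
      finally show ?thesis by (simp add: dist_real_def)
    qed
    then show "\<forall>\<^sub>F x in at x0. dist (\<integral>y. F (x, y) \<partial>m) (\<integral>y. F (x0, y) \<partial>m) < e"
      using X0(1,2) unfolding eventually_at_topological by blast
  qed
  then show ?thesis by (simp add: continuous_on_def)
qed

text \<open>For a fixed measure \<open>m\<close> the integral \<open>\<integral>F (x, \<cdot>) dm\<close> either vanishes for all \<open>x\<close> or stays
  positive, hence in the region where \<open>G\<close> is continuous.\<close>

lemma integral_cost_continuous:
  fixes F :: "'a::topological_space \<times> 'b::topological_space \<Rightarrow> real" and G :: "real \<Rightarrow> real"
  assumes compact: "compact (UNIV :: 'a set)" "compact (UNIV :: 'b set)"
    and F: "continuous_on UNIV F" "\<And>z. 0 < F z" and G: "G differentiable_on {0<..}"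
    and m: "m \<in> Borel_fin_measures"
  shows "continuous_on UNIV (\<lambda>x. G (\<integral>y. F (x, y) \<partial>m))"
proof -
  note int = continuous_section_integrable[OF compact F(1) m]
  have zero: "(\<integral>y. F (x, y) \<partial>m) = 0 \<longleftrightarrow> (AE y in m. False)" for x
    using integral_nonneg_eq_0_iff_AE[OF int[of x]] F(2)
    by (simp add: less_imp_le less_imp_neq[symmetric])
  have nonneg: "0 \<le> (\<integral>y. F (x, y) \<partial>m)" for x
    by (intro integral_nonneg_AE AE_I2) (simp add: F(2) less_imp_le)
  show ?thesis
  proof (cases "AE y in m. False")
    case True
    then have "(\<integral>y. F (x, y) \<partial>m) = 0" for x using zero by simp
    then show ?thesis by simp
  next
    case False
    then have "0 < (\<integral>y. F (x, y) \<partial>m)" for x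
      using zero[of x] nonneg[of x] by linarith
    then show ?thesis
      by (intro continuous_on_compose2[OF differentiable_on_pos_continuous[OF G]
            continuous_on_integral_section[OF compact F(1) m]]) auto
  qed
qed

text \<open>The infimum ranges over uncountably many measures, so measurability of each term would not
  suffice; but the terms are continuous, hence their infimum is upper semicontinuous.\<close>

lemma K_transform_measurable:
  fixes F :: "'a::topological_space \<times> 'b::topological_space \<Rightarrow> real"
  assumes compact: "compact (UNIV :: 'a set)" "compact (UNIV :: 'b set)"
    and F: "continuous_on UNIV F" "\<And>z. 0 < F z" and G: "G differentiable_on {0<..}"
  shows "K_transform (integral_cost G F) f \<in> borel_measurable borel"
proof (rule borel_measurableI_less)
  fix a :: ereal
  let ?M = "{m \<in> Borel_fin_measures. integrable m f}"
  let ?k = "\<lambda>m x. ereal ((\<integral>y. f y \<partial>m) + G (\<integral>y. F (x, y) \<partial>m))"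
  have "open {x. ?k m x < a}" if "m \<in> ?M" for m
    using integral_cost_continuous[OF compact F G, of m] that
    by (intro open_Collect_less continuous_intros) auto
  then have "open (\<Union>m\<in>?M. {x. ?k m x < a})" by blast
  moreover have "{x. K_transform (integral_cost G F) f x < a} = (\<Union>m\<in>?M. {x. ?k m x < a})"
    by (auto simp: K_transform_def INF_less_iff integral_cost_def)
  ultimately show "{x \<in> space borel. K_transform (integral_cost G F) f x < a} \<in> sets borel"
    by simp
qed

section \<open>Equality of integrals forces pointwise minimality\<close>

lemma ereal_integral_finiteD:
  fixes h :: "'a \<Rightarrow> ereal"
  assumes h[measurable]: "h \<in> borel_measurable M" and fin: "ereal_integral M h = ereal r"
  shows "AE x in M. \<bar>h x\<bar> \<noteq> \<infinity>"
    and "integrable M (\<lambda>x. real_of_ereal (h x))"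
    and "(\<integral>x. real_of_ereal (h x) \<partial>M) = r"
proof -
  define P where "P = (\<integral>\<^sup>+x. e2ennreal (h x) \<partial>M)"
  define N where "N = (\<integral>\<^sup>+x. e2ennreal (- h x) \<partial>M)"
  have eq: "enn2ereal P - enn2ereal N = ereal r"
    using fin by (simp add: ereal_integral_def P_def N_def)
  have P: "P \<noteq> \<infinity>" and N: "N \<noteq> \<infinity>"
    using eq by (cases P; cases N; simp)+
  have "AE x in M. e2ennreal (h x) \<noteq> \<infinity>" "AE x in M. e2ennreal (- h x) \<noteq> \<infinity>"
    using P N unfolding P_def N_def by (intro nn_integral_noteq_infinite; simp)+
  then show ae: "AE x in M. \<bar>h x\<bar> \<noteq> \<infinity>"
  proof eventually_elim
    case (elim x)
    then show ?case by (cases "h x") auto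
  qed
  have P': "(\<integral>\<^sup>+x. ennreal (real_of_ereal (h x)) \<partial>M) = P"
    unfolding P_def using ae by (intro nn_integral_cong_AE) (auto elim!: eventually_mono)
  have N': "(\<integral>\<^sup>+x. ennreal (- real_of_ereal (h x)) \<partial>M) = N"
    unfolding N_def using ae by (intro nn_integral_cong_AE) (auto elim!: eventually_mono)
  show int: "integrable M (\<lambda>x. real_of_ereal (h x))"
    using P N P' N' by (simp add: real_integrable_def)
  show "(\<integral>x. real_of_ereal (h x) \<partial>M) = r"
    using eq P N unfolding real_lebesgue_integral_def[OF int] P' N'
    by (cases P; cases N) (auto simp: enn2ereal_ennreal)
qed

text \<open>The tangent of \<open>G\<close> at \<open>1\<close> bounds the cost from below by an integrable function, so the
  value \<open>-\<infinity>\<close> is excluded and a finite upper bound already gives integrability.\<close>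

lemma integral_cost_integrable:
  fixes G :: "real \<Rightarrow> real"
  assumes convex: "convex_on {0..} G" and diff: "G differentiable_on {0<..}"
    and M: "finite_measure M" and u: "integrable M u" "\<And>x. 0 \<le> u x"
    and upper: "ereal_integral M (\<lambda>x. ereal (G (u x))) < \<infinity>"
  shows "integrable M (\<lambda>x. G (u x))"
    and "ereal_integral M (\<lambda>x. ereal (G (u x))) = ereal (\<integral>x. G (u x) \<partial>M)"
proof -
  define b where "b = deriv G 1"
  define a where "a = G 1 - b"
  have meas[measurable]: "(\<lambda>x. G (u x)) \<in> borel_measurable M"
    using differentiable_on_pos_borel_measurable[OF diff borel_measurable_integrable[OF u(1)]] u(2) by blast
  have lower: "a + b * u x \<le> G (u x)" for x
    using convex_above_tangent_at_pos[OF convex diff, of 1 "u x"] u(2)[of x]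
    by (simp add: a_def b_def algebra_simps)
  have int: "integrable M (\<lambda>x. a + b * u x)"
    using u(1) M by (simp add: finite_measure.integrable_const)
  have "(\<integral>\<^sup>+x. ennreal (- G (u x)) \<partial>M) \<le> (\<integral>\<^sup>+x. ennreal (- (a + b * u x)) \<partial>M)"
    using lower by (intro nn_integral_mono ennreal_leI) (simp only: neg_le_iff_le)
  also have "\<dots> < \<infinity>" using int by (simp add: real_integrable_def less_top)
  finally have neg: "(\<integral>\<^sup>+x. ennreal (- G (u x)) \<partial>M) < \<infinity>" .
  define r where "r = enn2real (\<integral>\<^sup>+x. ennreal (G (u x)) \<partial>M)
    - enn2real (\<integral>\<^sup>+x. ennreal (- G (u x)) \<partial>M)"
  have fin: "ereal_integral M (\<lambda>x. ereal (G (u x))) = ereal r"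
    using upper neg unfolding ereal_integral_def r_def
    by (cases "\<integral>\<^sup>+x. ennreal (G (u x)) \<partial>M"; cases "\<integral>\<^sup>+x. ennreal (- G (u x)) \<partial>M")
      (auto simp: enn2ereal_ennreal)
  have ereal_meas: "(\<lambda>x. ereal (G (u x))) \<in> borel_measurable M" by measurable
  show "integrable M (\<lambda>x. G (u x))"
    and "ereal_integral M (\<lambda>x. ereal (G (u x))) = ereal (\<integral>x. G (u x) \<partial>M)"
    using ereal_integral_finiteD(2,3)[OF ereal_meas fin] fin by simp_all
qed

lemma ereal_integral_eq_imp_AE_eq:
  fixes k :: "'a \<Rightarrow> ereal" and g :: "'a \<Rightarrow> real"
  assumes k: "k \<in> borel_measurable M" and g: "integrable M g"
    and le: "AE x in M. k x \<le> ereal (g x)"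
    and eq: "ereal_integral M k = ereal (\<integral>x. g x \<partial>M)"
  shows "AE x in M. k x = ereal (g x)"
proof -
  note D = ereal_integral_finiteD[OF k eq]
  let ?r = "\<lambda>x. real_of_ereal (k x)"
  have nonneg: "AE x in M. 0 \<le> g x - ?r x"
    using le D(1)
  proof eventually_elim
    case (elim x)
    then show ?case by (cases "k x") auto
  qed
  have "(\<integral>x. g x - ?r x \<partial>M) = 0" using D(2,3) g by simp
  then have "AE x in M. g x - ?r x = 0"
    using integral_nonneg_eq_0_iff_AE[OF _ nonneg] D(2) g by simp
  then show ?thesis
    using D(1)
  proof eventually_elim
    case (elim x)
    then show ?case by (cases "k x") auto
  qed
qed

lemma kernels_section_integrable:
  fixes F :: "'a::topological_space \<times> 'b::topological_space \<Rightarrow> real"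
  assumes compact: "compact (UNIV :: 'a set)" "compact (UNIV :: 'b set)"
    and F: "continuous_on UNIV F" "\<And>z. 0 < F z"
    and \<mu>: "sets \<mu> = sets borel" and \<nu>: "\<nu> \<in> Borel_probs" and q: "q \<in> kernels \<mu> \<nu>"
  shows "integrable \<mu> (\<lambda>x. \<integral>y. F (x, y) \<partial>q x)"
proof -
  have ker: "nonneg_kernel q" using q by (simp add: kernels_def)
  have qx: "q x \<in> Borel_fin_measures" for x using ker by (simp add: nonneg_kernel_def)
  have space_q: "space (q x) = UNIV" for x
    using qx[of x] sets_eq_imp_space_eq[of "q x" borel] by (simp add: Borel_fin_measures_def)
  obtain B where B: "0 < B" "\<And>z. \<bar>F z\<bar> \<le> B"
    using continuous_compact_product_bound[OF compact F(1)] by metis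
  have eq: "ennreal (\<integral>y. F (x, y) \<partial>q x) = (\<integral>\<^sup>+y. ennreal (F (x, y)) \<partial>q x)" for x
    using continuous_section_integrable[OF compact F(1) qx] F(2)
    by (intro nn_integral_eq_integral[symmetric]) (auto simp: less_imp_le)
  have nonneg: "0 \<le> (\<integral>y. F (x, y) \<partial>q x)" for x
    by (intro integral_nonneg_AE AE_I2) (simp add: F(2) less_imp_le)
  note [measurable] = continuous_compact_product_measurable[OF compact F(1)]
  have "(\<lambda>x. \<integral>\<^sup>+y. ennreal (F (x, y)) \<partial>q x) \<in> borel_measurable borel"
    by (rule nonneg_kernel_nn_integral_measurable[OF ker]) measurable
  then have "(\<lambda>x. enn2real (ennreal (\<integral>y. F (x, y) \<partial>q x))) \<in> borel_measurable borel"
    unfolding eq by measurable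
  then have meas: "(\<lambda>x. \<integral>y. F (x, y) \<partial>q x) \<in> borel_measurable \<mu>"
    using nonneg \<mu> by (simp cong: measurable_cong_sets)
  have "(\<integral>\<^sup>+x. ennreal (\<integral>y. F (x, y) \<partial>q x) \<partial>\<mu>) \<le> (\<integral>\<^sup>+x. \<integral>\<^sup>+y. ennreal B \<partial>q x \<partial>\<mu>)"
    unfolding eq using B(2) by (intro nn_integral_mono ennreal_leI) (meson abs_le_D1)
  also have "\<dots> = (\<integral>\<^sup>+y. ennreal B \<partial>\<nu>)"
    using \<nu> by (intro kernels_nn_integral[OF q \<mu>]) (auto simp: Borel_probs_def)
  also have "\<dots> < \<infinity>"
    using \<nu> prob_space.emeasure_space_1[of \<nu>] by (auto simp: Borel_probs_def)
  finally show ?thesis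
    using meas nonneg by (simp add: integrable_iff_bounded)
qed

section \<open>Optimality conditions for the transport problem\<close>

text \<open>The hypotheses say that the functions \<open>x \<mapsto> \<integral>f dq x + c x (q x)\<close> and \<open>K_transform c f\<close>, the
  first of which dominates the second, have the same finite integral.\<close>

lemma dual_optimizer_attains_K_transform:
  fixes F :: "'a::topological_space \<times> 'b::topological_space \<Rightarrow> real"
    and G :: "real \<Rightarrow> real" and q :: "'a \<Rightarrow> 'b measure" and f :: "'b \<Rightarrow> real"
  assumes compact: "compact (UNIV :: 'a set)" "compact (UNIV :: 'b set)"
    and F: "continuous_on UNIV F" "\<And>z. 0 < F z"
    and convex: "convex_on {0..} G" and diff: "G differentiable_on {0<..}"
    and \<mu>: "\<mu> \<in> Borel_probs" and \<nu>: "\<nu> \<in> Borel_probs" and q: "q \<in> kernels \<mu> \<nu>"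
    and f: "integrable \<nu> f"
    and finite: "ereal_integral \<mu> (\<lambda>x. integral_cost G F x (q x)) < \<infinity>"
    and dual: "ereal_integral \<mu> (\<lambda>x. integral_cost G F x (q x)) =
      ereal_integral \<mu> (K_transform (integral_cost G F) f) - ereal (\<integral>y. f y \<partial>\<nu>)"
  shows "AE x in \<mu>. integrable (q x) f \<and>
    K_transform (integral_cost G F) f x = ereal ((\<integral>y. f y \<partial>q x) + G (\<integral>y. F (x, y) \<partial>q x))"
proof -
  let ?c = "integral_cost G F"
  define u where "u x = (\<integral>y. F (x, y) \<partial>q x)" for x
  have sets: "sets \<mu> = sets borel" "sets \<nu> = sets borel" and fin: "finite_measure \<mu>"
    using \<mu> \<nu> by (auto simp: Borel_probs_def prob_space.finite_measure)
  have qx: "q x \<in> Borel_fin_measures" for x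
    using q by (simp add: kernels_def nonneg_kernel_def)
  have u: "integrable \<mu> u"
    unfolding u_def by (rule kernels_section_integrable[OF compact F sets(1) \<nu> q])
  have u0: "0 \<le> u x" for x
    unfolding u_def by (intro integral_nonneg_AE AE_I2) (simp add: F(2) less_imp_le)
  have c_eq: "(\<lambda>x. ?c x (q x)) = (\<lambda>x. ereal (G (u x)))"
    by (simp add: integral_cost_def u_def)
  note cost = integral_cost_integrable[OF convex diff fin u u0 finite[unfolded c_eq]]
  obtain g where g: "integrable \<mu> g" "(\<integral>x. g x \<partial>\<mu>) = (\<integral>y. f y \<partial>\<nu>)"
    and g_eq: "AE x in \<mu>. integrable (q x) f \<and> (\<integral>y. f y \<partial>q x) = g x"
    using kernels_integral[OF q sets f] by metis
  have "ereal (\<integral>x. G (u x) \<partial>\<mu>) = ereal_integral \<mu> (K_transform ?c f) - ereal (\<integral>y. f y \<partial>\<nu>)"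
    using dual cost(2) unfolding c_eq by simp
  then have "ereal_integral \<mu> (K_transform ?c f) = ereal (\<integral>x. g x + G (u x) \<partial>\<mu>)"
    using g cost(1) by (cases "ereal_integral \<mu> (K_transform ?c f)") auto
  moreover have "AE x in \<mu>. K_transform ?c f x \<le> ereal (g x + G (u x))"
    using g_eq
  proof eventually_elim
    case (elim x)
    then have "K_transform ?c f x \<le> ereal (\<integral>y. f y \<partial>q x) + ?c x (q x)"
      unfolding K_transform_def using qx by (intro INF_lower) simp
    then show ?case using elim by (simp add: integral_cost_def u_def)
  qed
  moreover have "K_transform ?c f \<in> borel_measurable \<mu>"
    using K_transform_measurable[OF compact F diff, of f] sets(1)
    by (simp cong: measurable_cong_sets)
  moreover have "integrable \<mu> (\<lambda>x. g x + G (u x))" using g(1) cost(1) by simp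
  ultimately have "AE x in \<mu>. K_transform ?c f x = ereal (g x + G (u x))"
    by (intro ereal_integral_eq_imp_AE_eq)
  with g_eq show ?thesis
    by eventually_elim (simp add: u_def)
qed

theorem proposition4p1:
  fixes F :: "'a::topological_space \<times> 'b::topological_space \<Rightarrow> real"
    and G :: "real \<Rightarrow> real"
    and c :: "'a \<Rightarrow> 'b measure \<Rightarrow> ereal"
    and \<mu> :: "'a measure" and \<nu> :: "'b measure"
    and q :: "'a \<Rightarrow> 'b measure" and f :: "'b \<Rightarrow> real"
  assumes "compact_space (euclidean :: 'a topology)" "metrizable_space (euclidean :: 'a topology)"
    and "compact_space (euclidean :: 'b topology)" "metrizable_space (euclidean :: 'b topology)"
    and "continuous_on UNIV F" and "\<And>z. 0 < F z"
    and "convex_on {0..} G" and "G differentiable_on {0<..}"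
    and c: "c = integral_cost G F"
    and "lower_semicontinuous_map (prod_topology euclidean weak_measure_topology) (\<lambda>(x, m). c x m)"
    and "\<mu> \<in> Borel_probs" and "\<nu> \<in> Borel_probs"
    and "transport_value c \<mu> \<nu> < \<infinity>"
    and "q \<in> kernels \<mu> \<nu>"
    and "transport_value c \<mu> \<nu> = ereal_integral \<mu> (\<lambda>x. c x (q x))"
    and "integrable \<nu> f"
    and "transport_value c \<mu> \<nu> = ereal_integral \<mu> (K_transform c f) - ereal (\<integral>y. f y \<partial>\<nu>)"
  shows "(AE x in \<mu>. \<forall>y. 0 \<le> ext_deriv G (\<integral>z. F (x, z) \<partial>q x) * ereal (F (x, y)) + ereal (f y)) \<and>
    (ext_deriv G 0 = -\<infinity> \<longrightarrow> (AE x in \<mu>. 0 < emeasure (q x) UNIV)) \<and>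
    (AE x in \<mu>. AE y in q x.
       ext_deriv G (\<integral>z. F (x, z) \<partial>q x) * ereal (F (x, y)) + ereal (f y) = 0)"
proof -
  have compact: "compact (UNIV :: 'a set)" "compact (UNIV :: 'b set)"
    using assms(1,3) by (simp_all add: compact_space_def)
  note F = assms(5,6)
  have qx: "q x \<in> Borel_fin_measures" for x
    using \<open>q \<in> kernels \<mu> \<nu>\<close> by (simp add: kernels_def nonneg_kernel_def)
  have sets_q: "sets (q x) = sets borel" for x
    using qx[of x] by (simp add: Borel_fin_measures_def)
  have f_meas: "f \<in> borel_measurable borel"
    using assms(12,16)
    by (auto simp: Borel_probs_def dest!: borel_measurable_integrable cong: measurable_cong_sets)
  have "AE x in \<mu>. integrable (q x) f \<and>
    K_transform c f x = ereal ((\<integral>y. f y \<partial>q x) + G (\<integral>y. F (x, y) \<partial>q x))"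
    using assms(13,15,17) unfolding c
    by (intro dual_optimizer_attains_K_transform[OF compact F assms(7,8,11,12,14,16)]) simp_all
  then have opt: "AE x in \<mu>.
    (\<forall>y. 0 \<le> ext_deriv G (\<integral>z. F (x, z) \<partial>q x) * ereal (F (x, y)) + ereal (f y)) \<and>
    (AE y in q x. ext_deriv G (\<integral>z. F (x, z) \<partial>q x) * ereal (F (x, y)) + ereal (f y) = 0)"
  proof eventually_elim
    case (elim x)
    have min: "(\<integral>y. f y \<partial>q x) + G (\<integral>y. F (x, y) \<partial>q x) \<le> (\<integral>y. f y \<partial>m) + G (\<integral>y. F (x, y) \<partial>m)"
      if "m \<in> Borel_fin_measures" "integrable m f" for m
    proof -
      have "K_transform c f x \<le> ereal (\<integral>y. f y \<partial>m) + c x m"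
        unfolding K_transform_def using that by (intro INF_lower) simp
      then show ?thesis using elim by (simp add: c integral_cost_def)
    qed
    show ?case
      using minimizing_measure_optimality[OF assms(7,8) qx conjunct1[OF elim]
          continuous_section_integrable[OF compact F(1) qx] F(2) f_meas
          continuous_section_measurable[OF F(1)] min]
      by blast
  qed
  have "AE x in \<mu>. 0 < emeasure (q x) UNIV" if deriv: "ext_deriv G 0 = -\<infinity>"
    using opt
  proof eventually_elim
    case (elim x)
    show ?case
    proof (rule ccontr)
      assume "\<not> 0 < emeasure (q x) UNIV"
      then have "emeasure (q x) (space (q x)) = 0"
        using sets_eq_imp_space_eq[OF sets_q[of x]] by simp
      then have "AE z in q x. F (x, z) = 0"
        by (intro AE_I[where N = "space (q x)"]) auto
      then have "(\<integral>z. F (x, z) \<partial>q x) = 0" by (rule integral_eq_zero_AE)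
      with elim deriv have "0 \<le> -\<infinity> * ereal (F (x, undefined)) + ereal (f undefined)" by metis
      then show False using F(2)[of "(x, undefined)"] by simp
    qed
  qed
  then show ?thesis using opt by (auto elim: eventually_mono)
qed

end
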